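(* Let $k\geq 3$ be odd and let $g$ be a permutation with support size $s$. Then there is a Stirling function $(n,m)\mapsto\big[{n\atop m}\big]_{g}$ with threshold $t=\max\{s,4k\}$ such that $$\Phi(\Gamma^{k}_{n};\,r,g)=\Big[{n\atop n-rk}\Big]_{g}+\Big[{n\atop n-(r-1)k}\Big]_{g}$$ for all $n>t$ and all $r\geq 3$.
   Context: For an integer $t\geq 0$ let $\mathbb{N}_t=\{n\in\mathbb{Z}: n\geq t\}$. A function $\mathbb{N}_t\times\mathbb{Z}\to\mathbb{N}_0$, $(n,m)\mapsto\big[{n\atop m}\big]$, is a Stirling function with threshold $t$ if for all $n>t$ and all $m\in\mathbb{Z}$ it satisfies $\big[{n\atop m}\big]=\big[{n-1\atop m-1}\big]+(n-1)\big[{n-1\atop m}\big]$, and $\big[{n\atop m}\big]=0$ whenever $m>n$. (The values at $n=t$ are the arbitrary initial values.) For $k\geq 1$ and $n\geq 2k$, a $k$-transposition in $\mathrm{Sym}(n)$ is a permutation of cycle shape $(a_1\,b_1)\cdots(a_k\,b_k)$, i.e. a product of $k$ pairwise disjoint transpositions. Let $H$ be the set of all $k$-transpositions in $\mathrm{Sym}(n)$; for $k$ odd it generates $\mathrm{Sym}(n)$. The $k$-transposition Cayley graph $\Gamma^k_n$ ($k$ odd) has vertex set $\mathrm{Sym}(n)$, with $u\neq v$ joined by an edge if and only if $v=uh$ for some $h\in H$. Let $\mathrm{d}$ be its graph distance and let $B_r(\Gamma^k_n,g)=\{u\in \mathrm{Sym}(n):\mathrm{d}(g,u)\leq r\}$.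 The metric intersection numbers are $\Phi(\Gamma^k_n;\,r,g)=|B_r(\Gamma^k_n,e)\cap B_r(\Gamma^k_n,g)|$, where $e$ is the identity. The support size of a permutation $g$ of some finite set is the number of elements moved by $g$. A permutation $g$ with support size $s$ is viewed as an element of $\mathrm{Sym}(n)$ for every $n\geq s$, by identifying the moved set with a subset of $\{1,\dots,n\}$; the value $\Phi(\Gamma^k_n;\,r,g)$ does not depend on the identification. *)

theory Defs
  imports
    "HOL-Combinatorics.Permutations"
    "Graph_Theory.Pair_Digraph"
    "Graph_Theory.Shortest_Path"
begin

text \<open>
  A Stirling function with threshold \<open>t\<close> lives on \<open>{n. n \<ge> t} \<times> \<int>\<close>. It is encoded as a
  total function whose values for \<open>n < t\<close> are irrelevant. In the recursion \<open>n > t \<ge> 0\<close>,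
  so the natural number \<open>n - 1\<close> is not truncated.
\<close>
definition stirling_function :: "nat \<Rightarrow> (nat \<Rightarrow> int \<Rightarrow> nat) \<Rightarrow> bool" where
  "stirling_function t F \<longleftrightarrow>
     (\<forall>n>t. \<forall>m. F n m = F (n - 1) (m - 1) + (n - 1) * F (n - 1) m) \<and>
     (\<forall>n\<ge>t. \<forall>m. m > int n \<longrightarrow> F n m = 0)"

definition Sym :: "nat \<Rightarrow> (nat \<Rightarrow> nat) set" where
  "Sym n = {p. p permutes {1..n}}"

definition k_transpositions :: "nat \<Rightarrow> nat \<Rightarrow> (nat \<Rightarrow> nat) set" where
  "k_transpositions k n =
     {foldr (\<circ>) (map2 transpose xs ys) id | xs ys.
        length xs = k \<and> length ys = k \<and> distinct (xs @ ys) \<and> set (xs @ ys) \<subseteq> {1..n}}"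

text \<open>
  The undirected Cayley graph is represented by its symmetric digraph. The group product
  \<open>u h\<close> is \<open>u \<circ> h\<close>; as the set of \<open>k\<close>-transpositions is closed under conjugation, composing
  in the other order gives the same graph.
\<close>
definition transposition_graph :: "nat \<Rightarrow> nat \<Rightarrow> (nat \<Rightarrow> nat) pair_pre_digraph" where
  "transposition_graph k n =
     \<lparr> pverts = Sym n,
       parcs = {(u, v). u \<in> Sym n \<and> v \<in> Sym n \<and> u \<noteq> v \<and>
                        (\<exists>h \<in> k_transpositions k n. v = u \<circ> h)} \<rparr>"

text \<open>Graph distance is the infimum of the costs of walks, with all arcs of weight 1.\<close>
definition graph_dist :: "'a pair_pre_digraph \<Rightarrow> 'a \<Rightarrow> 'a \<Rightarrow> ereal" where
  "graph_dist G u v = wf_digraph.\<mu> (with_proj G) (\<lambda>_. 1) u v"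

definition graph_ball :: "'a pair_pre_digraph \<Rightarrow> nat \<Rightarrow> 'a \<Rightarrow> 'a set" where
  "graph_ball G r g = {u \<in> pverts G. graph_dist G g u \<le> ereal (real r)}"

definition metric_intersection :: "nat \<Rightarrow> nat \<Rightarrow> nat \<Rightarrow> (nat \<Rightarrow> nat) \<Rightarrow> nat" where
  "metric_intersection k n r g =
     card (graph_ball (transposition_graph k n) r id \<inter> graph_ball (transposition_graph k n) r g)"

definition perm_support :: "('a \<Rightarrow> 'a) \<Rightarrow> 'a set" where
  "perm_support g = {x. g x \<noteq> x}"

lemma k_transpositions_subset_Sym: "k_transpositions k n \<subseteq> Sym n"
proof -
  have "foldr (\<circ>) (map2 transpose xs ys) id permutes {1..n}"
    if "length xs = length ys" "set xs \<subseteq> {1..n}" "set ys \<subseteq> {1..n}" for xs ys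
    using that
    by (induction xs ys rule: list_induct2) (auto intro: permutes_compose permutes_swap_id permutes_id
        simp del: atLeastAtMost_iff)
  then show ?thesis
    by (auto simp: k_transpositions_def Sym_def)
qed

text \<open>The unfolding of \<open>\<mu>\<close> is only available for well-formed digraphs.\<close>
lemma wf_transposition_graph: "wf_digraph (with_proj (transposition_graph k n))"
  by unfold_locales (auto simp: transposition_graph_def)

lemma foldr_transpose_inverse:
  assumes "length xs = length ys" "distinct (xs @ ys)"
  shows "foldr (\<circ>) (map2 transpose xs ys) id \<circ> foldr (\<circ>) (map2 transpose xs ys) id = id"
  using assms
proof (induction xs ys rule: list_induct2)
  case Nil
  then show ?case by simp
next
  case (Cons a xs b ys)
  define f where "f = foldr (\<circ>) (map2 transpose xs ys) id"
  have fixpt: "foldr (\<circ>) (map2 transpose xs ys) id x = x"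
    if "length xs = length ys" "x \<notin> set xs" "x \<notin> set ys" for x :: 'a and xs ys
    using that by (induction xs ys rule: list_induct2) (auto simp: transpose_def)
  have ff: "f \<circ> f = id"
    unfolding f_def by (rule Cons.IH) (use Cons.prems in auto)
  have "f a = a" "f b = b"
    using Cons by (auto simp: f_def intro!: fixpt)
  then have "f x \<noteq> a \<and> f x \<noteq> b" if "x \<noteq> a" "x \<noteq> b" for x
    using that ff by (metis comp_apply id_apply)
  then have "transpose a b \<circ> f \<circ> (transpose a b \<circ> f) = id"
    using ff \<open>f a = a\<close> \<open>f b = b\<close> by (force simp: fun_eq_iff transpose_def)
  moreover have "foldr (\<circ>) (map2 transpose (a # xs) (b # ys)) id = transpose a b \<circ> f"
    by (simp add: f_def fun_eq_iff)
  ultimately show ?case by (simp only:)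
qed

lemma symmetric_transposition_graph: "symmetric (with_proj (transposition_graph k n))"
proof -
  have "u \<circ> h \<circ> h = u" if "h \<in> k_transpositions k n" for u h :: "nat \<Rightarrow> nat"
  proof -
    have "h \<circ> h = id"
      using that by (auto simp: k_transpositions_def foldr_transpose_inverse simp del: distinct_append)
    then show ?thesis by (simp add: comp_assoc)
  qed
  then show ?thesis
    unfolding symmetric_def sym_def by (fastforce simp: transposition_graph_def)
qed

end

theory Submission
  imports Defs "HOL-Combinatorics.Cycles"
begin

text \<open>
  Let the length of a permutation be the least number of transpositions of which it is a
  product. The main point is that, for \<open>n \<ge> 4k\<close> and \<open>r \<ge> 2\<close>, the products of exactly \<open>r\<close>
  \<open>k\<close>-transpositions are the permutations of length at most \<open>r k\<close> whose parity is that of \<open>r k\<close>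
  (\<open>k_products_eq\<close>). Only the existence of such products needs an argument. Each cycle is
  a product of two reflections, which together use as few transpositions as possible; so every
  permutation is a product of two involutions whose numbers of transpositions add up to
  its length, and these numbers can be made to differ by at most one
  (\<open>cycle_decomp_two_matchings\<close>). Parts of these involutions, filled up with transpositions on
  free points, give the \<open>k\<close>-transpositions: two of them at once for even length at most \<open>2k\<close>
  (\<open>two_k_transpositions\<close>), and one for each further factor (\<open>peel_k_transposition\<close>).

  Hence, for \<open>r \<ge> 3\<close>, membership in a ball is a condition on the length: it is at most \<open>r k\<close> with the
  parity of \<open>r k\<close>, or at most \<open>(r - 1) k\<close> with the parity of \<open>(r - 1) k\<close> (\<open>graph_ball_eq\<close>). Replacing
  \<open>r k\<close> by an arbitrary integer \<open>d\<close>, let \<open>C n (n - d)\<close> be the number of \<open>u\<close> in \<open>Sym n\<close> such that \<open>u\<close> and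
  \<open>inv g u\<close> both satisfy this condition. Writing \<open>u\<close> as \<open>(n b) q\<close> with \<open>q\<close> in \<open>Sym (n - 1)\<close> raises both
  lengths by one for the \<open>n - 1\<close> choices \<open>b < n\<close> and leaves them alone for \<open>b = n\<close>, and this is the
  Stirling recursion for \<open>C\<close> (\<open>ball_count_Suc\<close>).

  It remains to write \<open>C n m\<close> as \<open>F n m + F n (m + k)\<close> with a single Stirling function \<open>F\<close> that does not
  depend on \<open>r\<close>. The condition for \<open>d - k\<close> implies the one for \<open>d\<close>, so \<open>C n (m + k) \<le> C n m\<close>, and the
  alternating sum \<open>C n m - C n (m + k) + C n (m + 2k) - \<dots>\<close> is nonnegative; as the recursion is linear
  with a coefficient that does not involve \<open>m\<close>, this sum is again a Stirling function
  (\<open>stirling_function_split\<close>). Finally, all embeddings of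
  \<open>g\<close> into \<open>Sym n\<close> are conjugate, and conjugation preserves lengths.
\<close>

section \<open>Transposition length\<close>

definition transp_length :: "('a \<Rightarrow> 'a) \<Rightarrow> nat" where
  "transp_length p = (LEAST n. swapidseq n p)"

lemma swapidseq_transp_length: "permutation p \<Longrightarrow> swapidseq (transp_length p) p"
  unfolding transp_length_def permutation_def by (rule LeastI_ex)

lemma transp_length_le: "swapidseq n p \<Longrightarrow> transp_length p \<le> n"
  unfolding transp_length_def by (rule Least_le)

lemma even_transp_length: "swapidseq n p \<Longrightarrow> even (transp_length p) \<longleftrightarrow> even n"
  using swapidseq_even_even swapidseq_transp_length permutation_def by blast

lemma transp_length_id [simp]: "transp_length id = 0"
  using transp_length_le[OF swapidseq.id] by simp

text \<open>
  A transposition that attaches a fixed point \<open>a\<close> of \<open>v\<close> to another point always lengthens \<open>v\<close>: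
  a shortest factorisation of the product can be rewritten so that \<open>a\<close> occurs in a single
  transposition, which is then dropped. Both the Stirling recursion and the length of a
  cycle rest on this fact.
\<close>
lemma transp_length_transpose_comp:
  assumes "permutation v" "v a = a" "a \<noteq> b"
  shows "transp_length (transpose a b \<circ> v) = Suc (transp_length v)"
proof (rule antisym)
  let ?w = "transpose a b \<circ> v"
  show "transp_length ?w \<le> Suc (transp_length v)"
    using assms by (intro transp_length_le comp_Suc swapidseq_transp_length)
  have w: "swapidseq (transp_length ?w) ?w"
    using assms by (intro swapidseq_transp_length permutation_compose permutation_swap_id)
  have v: "transpose a b \<circ> ?w = v"
    by (simp add: fun_eq_iff)
  show "Suc (transp_length v) \<le> transp_length ?w"
    using fixing_swapidseq_decrease[OF w assms(3)] transp_length_le[of "transp_length ?w - 1" v]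
      assms(2) unfolding v by linarith
qed

lemma swapidseq_conj:
  assumes "bij f" "swapidseq n p"
  shows "swapidseq n (f \<circ> p \<circ> inv f)"
  using assms(2)
proof induction
  case id
  have "f \<circ> id \<circ> inv f = id"
    using assms(1) by (simp only: comp_id bij_is_surj surj_iff[THEN iffD1])
  then show ?case by (simp only: swapidseq.id)
next
  case (comp_Suc n p a b)
  have "f \<circ> (transpose a b \<circ> p) \<circ> inv f = transpose (f a) (f b) \<circ> (f \<circ> p \<circ> inv f)"
    using assms(1) by (simp add: fun_eq_iff transpose_def bij_is_inj inj_eq)
  moreover have "f a \<noteq> f b"
    using comp_Suc assms(1) by (simp add: bij_is_inj inj_eq)
  ultimately show ?case
    using swapidseq.comp_Suc[OF comp_Suc.IH] by metis
qed

lemma transp_length_conj: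
  assumes "bij f"
  shows "transp_length (f \<circ> p \<circ> inv f) = transp_length p"
proof -
  have "inv f \<circ> (f \<circ> p \<circ> inv f) \<circ> inv (inv f) = p"
    using assms by (simp add: fun_eq_iff inv_inv_eq bij_is_inj)
  then have "swapidseq n (f \<circ> p \<circ> inv f) \<longleftrightarrow> swapidseq n p" for n
    using swapidseq_conj[OF assms] swapidseq_conj[OF bij_imp_bij_inv[OF assms]] by metis
  then show ?thesis
    unfolding transp_length_def by simp
qed

section \<open>Products of disjoint transpositions\<close>

lemma perm_support_comp: "perm_support (f \<circ> g) \<subseteq> perm_support f \<union> perm_support g"
  unfolding perm_support_def by auto

text \<open>
  \<open>matching k h\<close> says that \<open>h\<close> swaps the two ends of each of the \<open>k\<close> edges of a matching of
  the ground set and fixes all other points. This describes a \<open>k\<close>-transposition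
  without a choice of lists of points, and without reference to an ambient finite set.
\<close>
inductive matching :: "nat \<Rightarrow> ('a \<Rightarrow> 'a) \<Rightarrow> bool" where
  matching_id: "matching 0 id"
| matching_Suc: "matching k h \<Longrightarrow> a \<noteq> b \<Longrightarrow> h a = a \<Longrightarrow> h b = b \<Longrightarrow>
    matching (Suc k) (transpose a b \<circ> h)"

lemma matching_swapidseq: "matching k h \<Longrightarrow> swapidseq k h"
  by (induction rule: matching.induct) (rule swapidseq.id, rule comp_Suc)

lemma matching_bij: "matching k h \<Longrightarrow> bij h"
  using matching_swapidseq permutation_def permutation_bijective by blast

text \<open>
  The points moved by \<open>h\<close> and \<open>{a, b}\<close> are disjoint and both sets are invariant.
\<close>
lemma matching_moved_iff:
  assumes "matching k h" "a \<noteq> b" "h a = a" "h b = b"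
  shows "(transpose a b \<circ> h) x \<noteq> x \<longleftrightarrow> x = a \<or> x = b \<or> h x \<noteq> x"
proof (cases "x = a \<or> x = b")
  case False
  then have "h x \<noteq> a" "h x \<noteq> b"
    using assms(3,4) bij_is_inj[OF matching_bij[OF assms(1)]] by (metis injD)+
  with False show ?thesis by simp
qed (use assms in auto)

lemma perm_support_matching_Suc:
  assumes "matching k h" "a \<noteq> b" "h a = a" "h b = b"
  shows "perm_support (transpose a b \<circ> h) = insert a (insert b (perm_support h))"
  unfolding perm_support_def using matching_moved_iff[OF assms] by blast

lemma matching_involution: "matching k h \<Longrightarrow> h (h x) = x"
proof (induction arbitrary: x rule: matching.induct)
  case (matching_Suc k h a b)
  have "h x \<noteq> a \<and> h x \<noteq> b" if "x \<noteq> a" "x \<noteq> b"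
    using that matching_Suc by metis
  then show ?case
    using matching_Suc by (auto simp: transpose_def)
qed auto

lemma card_perm_support_matching:
  assumes "matching k h"
  shows "finite (perm_support h)" "card (perm_support h) = 2 * k"
proof -
  have "finite (perm_support h) \<and> card (perm_support h) = 2 * k"
    using assms
  proof induction
    case (matching_Suc k h a b)
    then have "a \<notin> perm_support h" "b \<notin> perm_support h"
      by (auto simp: perm_support_def)
    then show ?case
      using matching_Suc.IH matching_Suc.hyps
      unfolding perm_support_matching_Suc[OF matching_Suc.hyps] by simp
  qed (simp add: perm_support_def)
  then show "finite (perm_support h)" "card (perm_support h) = 2 * k" by auto
qed

lemma matching_comp:
  assumes "matching j h" "matching k h'" "\<And>x. h x = x \<or> h' x = x"
  shows "matching (j + k) (h \<circ> h')"
  using assms(1,3)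
proof (induction rule: matching.induct)
  case (matching_Suc j h a b)
  note moved = matching_moved_iff[OF matching_Suc.hyps]
  have "h x = x \<or> h' x = x" for x
    using moved[of x] matching_Suc.prems[of x] by blast
  then have "matching (j + k) (h \<circ> h')"
    by (rule matching_Suc.IH)
  moreover have "h' a = a" "h' b = b"
    using moved matching_Suc.prems by blast+
  ultimately have "matching (Suc (j + k)) (transpose a b \<circ> (h \<circ> h'))"
    using matching_Suc.hyps by (intro matching.matching_Suc) auto
  then show ?case
    by (simp only: comp_assoc add_Suc)
qed (simp only: id_comp add_0 assms(2))

lemma matching_split:
  assumes "matching (j + k) h"
  obtains h1 h2 where "matching j h1" "matching k h2" "h = h1 \<circ> h2"
    "\<And>x. h x = x \<Longrightarrow> h1 x = x"
proof -
  have "\<exists>h1 h2. matching j h1 \<and> matching k h2 \<and> h = h1 \<circ> h2 \<and>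
      (\<forall>x. h x = x \<longrightarrow> h1 x = x \<and> h2 x = x)"
    using assms
  proof (induction j arbitrary: h)
    case 0
    then have "matching k h"
      by simp
    moreover have "h = id \<circ> h" "id x = x" for x :: 'a
      by simp_all
    ultimately show ?case
      using matching_id by metis
  next
    case (Suc j)
    from Suc.prems obtain h' a b where h': "matching (j + k) h'" "a \<noteq> b" "h' a = a" "h' b = b"
      and h: "h = transpose a b \<circ> h'"
      by (auto elim: matching.cases)
    from Suc.IH[OF h'(1)] obtain h1 h2 where IH: "matching j h1" "matching k h2" "h' = h1 \<circ> h2"
      "\<And>x. h' x = x \<Longrightarrow> h1 x = x" "\<And>x. h' x = x \<Longrightarrow> h2 x = x"
      by blast
    have m: "matching (Suc j) (transpose a b \<circ> h1)"
      using IH h' by (intro matching_Suc) auto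
    have "(transpose a b \<circ> h1) x = x \<and> h2 x = x" if "h x = x" for x
      using that IH(4,5)[of x] matching_moved_iff[OF h', of x] unfolding h by auto
    moreover have "h = (transpose a b \<circ> h1) \<circ> h2"
      unfolding h IH(3) by (simp only: comp_assoc)
    ultimately show ?case
      using m IH(2) by blast
  qed
  with that show ?thesis by blast
qed

lemma matching_exists:
  assumes "finite X" "2 * j \<le> card X"
  obtains h where "matching j h" "\<And>x. x \<notin> X \<Longrightarrow> h x = x"
proof -
  have "\<exists>h. matching j h \<and> (\<forall>x. x \<notin> X \<longrightarrow> h x = x)"
    using assms
  proof (induction j arbitrary: X)
    case (Suc j)
    from Suc.prems obtain a where a: "a \<in> X" by fastforce
    have "card (X - {a}) > 0"
      using Suc.prems a by simp
    then obtain b where b: "b \<in> X - {a}" by (metis card_gt_0_iff ex_in_conv)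
    have "card (X - {a} - {b}) = card X - 2"
      using Suc.prems a b by (simp add: card_Diff_singleton)
    then have "2 * j \<le> card (X - {a} - {b})"
      using Suc.prems by simp
    with Suc.IH[of "X - {a} - {b}"] Suc.prems(1) obtain h
      where h: "matching j h" "\<And>x. x \<notin> X - {a} - {b} \<Longrightarrow> h x = x" by blast
    have "matching (Suc j) (transpose a b \<circ> h)"
      using h b by (intro matching_Suc) auto
    moreover have "(transpose a b \<circ> h) x = x" if "x \<notin> X" for x
    proof -
      have "x \<noteq> a" "x \<noteq> b"
        using that a b by blast+
      then show ?thesis
        using that h(2)[of x] by simp
    qed
    ultimately show ?case
      by blast
  next
    case 0
    then show ?case
      using matching_id by auto
  qed
  with that show ?thesis by blast
qed

lemma matching_of_lists:
  assumes "length xs = length ys" "distinct (xs @ ys)"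
  shows "matching (length xs) (foldr (\<circ>) (map2 transpose xs ys) id) \<and>
    perm_support (foldr (\<circ>) (map2 transpose xs ys) id) = set (xs @ ys)"
  using assms
proof (induction xs ys rule: list_induct2)
  case Nil
  then show ?case by (auto simp: perm_support_def id_def intro: matching_id[unfolded id_def])
next
  case (Cons a xs b ys)
  define h where "h = foldr (\<circ>) (map2 transpose xs ys) id"
  have d: "distinct (xs @ ys)"
    using Cons.prems by simp
  have h: "matching (length xs) h" "perm_support h = set (xs @ ys)"
    using Cons.IH[OF d] unfolding h_def by blast+
  have "h a = a" "h b = b" "a \<noteq> b"
    using Cons.prems h(2) by (auto simp: perm_support_def)
  with h have "matching (Suc (length xs)) (transpose a b \<circ> h)"
    "perm_support (transpose a b \<circ> h) = insert a (insert b (set (xs @ ys)))"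
    by (auto intro: matching_Suc simp: perm_support_matching_Suc)
  moreover have "foldr (\<circ>) (map2 transpose (a # xs) (b # ys)) id = transpose a b \<circ> h"
    by (simp add: h_def fun_eq_iff)
  moreover have "set ((a # xs) @ (b # ys)) = insert a (insert b (set (xs @ ys)))"
    by auto
  ultimately show ?case
    by (simp only: list.size add_Suc_right add_0_right simp_thms)
qed

lemma lists_of_matching:
  assumes "matching k h"
  shows "\<exists>xs ys. length xs = k \<and> length ys = k \<and> distinct (xs @ ys) \<and>
    set (xs @ ys) = perm_support h \<and> h = foldr (\<circ>) (map2 transpose xs ys) id"
  using assms
proof induction
  case matching_id
  then show ?case by (auto simp: perm_support_def)
next
  case (matching_Suc k h a b)
  then obtain xs ys where IH: "length xs = k" "length ys = k" "distinct (xs @ ys)"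
    "set (xs @ ys) = perm_support h" "h = foldr (\<circ>) (map2 transpose xs ys) id"
    by blast
  have "a \<notin> perm_support h" "b \<notin> perm_support h"
    using matching_Suc by (auto simp: perm_support_def)
  then have "distinct ((a # xs) @ (b # ys))"
    using IH(3) \<open>a \<noteq> b\<close> unfolding IH(4)[symmetric] by auto
  moreover have "set ((a # xs) @ (b # ys)) = perm_support (transpose a b \<circ> h)"
    using IH(4) matching_Suc by (auto simp: perm_support_matching_Suc)
  moreover have "transpose a b \<circ> h = foldr (\<circ>) (map2 transpose (a # xs) (b # ys)) id"
    unfolding IH(5) by (simp add: fun_eq_iff)
  moreover have "length (a # xs) = Suc k" "length (b # ys) = Suc k"
    using IH(1,2) by simp_all
  ultimately show ?case
    by blast
qed

lemma k_transpositions_iff_matching: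
  "h \<in> k_transpositions k n \<longleftrightarrow> matching k h \<and> perm_support h \<subseteq> {1..n}"
proof
  assume "h \<in> k_transpositions k n"
  then obtain xs ys where "length xs = k" "length ys = k" "distinct (xs @ ys)"
    "set (xs @ ys) \<subseteq> {1..n}" "h = foldr (\<circ>) (map2 transpose xs ys) id"
    unfolding k_transpositions_def by blast
  with matching_of_lists[of xs ys] show "matching k h \<and> perm_support h \<subseteq> {1..n}"
    by metis
next
  assume "matching k h \<and> perm_support h \<subseteq> {1..n}"
  with lists_of_matching[of k h] show "h \<in> k_transpositions k n"
    unfolding k_transpositions_def by fastforce
qed

section \<open>Permutations as products of two involutions\<close>

text \<open>
  The reversal of a list of distinct points swaps the first with the last point and reverses
  what is between them; so it pairs off all points, except the middle one if their number is odd.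
\<close>
lemma list_reversal_matching:
  assumes "distinct xs"
  obtains R where "matching (length xs div 2) R"
    "\<And>i. i < length xs \<Longrightarrow> R (xs ! i) = xs ! (length xs - 1 - i)"
    "\<And>x. x \<notin> set xs \<Longrightarrow> R x = x"
proof -
  have "\<exists>R. matching (length xs div 2) R \<and>
    (\<forall>i < length xs. R (xs ! i) = xs ! (length xs - 1 - i)) \<and> (\<forall>x. x \<notin> set xs \<longrightarrow> R x = x)"
    using assms
  proof (induction "length xs" arbitrary: xs rule: less_induct)
    case less
    show ?case
    proof (cases "length xs < 2")
      case True
      then have "length xs div 2 = 0" "\<And>i. i < length xs \<Longrightarrow> length xs - 1 - i = i"
        by auto
      then show ?thesis
        by (intro exI[of _ id]) (auto intro: matching_id)
    next
      case False
      then obtain x zs where "xs = x # zs" "zs \<noteq> []"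
        by (cases xs; cases "tl xs") auto
      then obtain ys z where xs: "xs = x # ys @ [z]"
        by (metis rev_exhaust)
      obtain R where R: "matching (length ys div 2) R"
        "\<And>i. i < length ys \<Longrightarrow> R (ys ! i) = ys ! (length ys - 1 - i)"
        "\<And>x. x \<notin> set ys \<Longrightarrow> R x = x"
        using less(1)[of ys] less(2) unfolding xs by auto
      have d: "x \<notin> set ys" "z \<notin> set ys" "x \<noteq> z"
        using less(2) unfolding xs by auto
      have m: "matching (length xs div 2) (transpose x z \<circ> R)"
        using R d matching_Suc[OF R(1), of x z] by (simp add: xs)
      have "(transpose x z \<circ> R) (xs ! i) = xs ! (length xs - 1 - i)" if i: "i < length xs" for i
      proof -
        consider "i = 0" | "i = Suc (length ys)" | j where "i = Suc j" "j < length ys"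
          using i unfolding xs by (cases i) (auto simp: less_Suc_eq)
        then show ?thesis
        proof cases
          case 1
          then show ?thesis using R(3) d by (simp add: xs nth_append)
        next
          case 2
          then show ?thesis using R(3) d by (simp add: xs nth_append)
        next
          case 3
          then have "R (xs ! i) = ys ! (length ys - 1 - j)"
            using R(2)[of j] by (simp add: xs nth_append)
          moreover have mem: "ys ! (length ys - 1 - j) \<in> set ys"
            using 3 by (intro nth_mem) auto
          moreover have "xs ! (length xs - 1 - i) = ys ! (length ys - 1 - j)"
          proof -
            have "length xs - 1 - i = Suc (length ys - 1 - j)" "length ys - 1 - j < length ys"
              using 3 by (simp_all add: xs)
            then show ?thesis
              by (simp only: xs nth_Cons_Suc nth_append if_True)
          qed
          moreover have "transpose x z (ys ! (length ys - 1 - j)) = ys ! (length ys - 1 - j)"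
            using mem d by (intro transpose_apply_other) metis+
          ultimately show ?thesis by simp
        qed
      qed
      moreover have "(transpose x z \<circ> R) y = y" if "y \<notin> set xs" for y
        using that R(3)[of y] by (simp add: xs)
      ultimately show ?thesis
        using m by blast
    qed
  qed
  with that show ?thesis by blast
qed

lemma cycle_of_list_nth:
  assumes "distinct cs" "i < length cs"
  shows "cycle_of_list cs (cs ! i) = cs ! (Suc i mod length cs)"
proof -
  have "cycle_of_list cs (cs ! i) = map (cycle_of_list cs ^^ 1) cs ! i"
    using assms(2) by simp
  also have "\<dots> = rotate1 cs ! i"
    unfolding cyclic_rotation[OF assms(1)] by simp
  finally show ?thesis
    using nth_rotate1[OF assms(2)] by simp
qed

text \<open>
  A rotation of an \<open>m\<close>-gon is the product of two reflections. The reflections are reversals: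
  \<open>R\<close> of the whole list, \<open>S\<close> of its tail and \<open>T\<close> of the list without its last point, so that
  \<open>S\<close> and \<open>T\<close> keep one point where it is and shift the axis of \<open>R\<close> by half a step. Together
  \<open>R\<close> and \<open>S\<close> use \<open>m - 1\<close> transpositions, which is the length of the cycle. For even \<open>m\<close> the
  numbers of \<open>R\<close> and \<open>S\<close> differ by one, and the two forms of the result allow the larger one to
  be put on either side.
\<close>
lemma cycle_eq_comp_matchings:
  assumes "distinct cs" "cs \<noteq> []"
  obtains R S T where
    "matching (length cs div 2) R" "matching ((length cs - 1) div 2) S"
    "matching ((length cs - 1) div 2) T"
    "cycle_of_list cs = S \<circ> R" "cycle_of_list cs = R \<circ> T"
    "perm_support R \<subseteq> set cs" "perm_support S \<subseteq> set cs" "perm_support T \<subseteq> set cs"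
proof -
  let ?m = "length cs"
  obtain R where R: "matching (?m div 2) R"
    "\<And>i. i < ?m \<Longrightarrow> R (cs ! i) = cs ! (?m - 1 - i)" "\<And>x. x \<notin> set cs \<Longrightarrow> R x = x"
    using list_reversal_matching[OF assms(1)] by metis
  obtain S where S: "matching (length (tl cs) div 2) S"
    "\<And>i. i < length (tl cs) \<Longrightarrow> S (tl cs ! i) = tl cs ! (length (tl cs) - 1 - i)"
    "\<And>x. x \<notin> set (tl cs) \<Longrightarrow> S x = x"
    using list_reversal_matching[OF distinct_tl[OF assms(1)]] by metis
  obtain T where T: "matching (length (butlast cs) div 2) T"
    "\<And>i. i < length (butlast cs) \<Longrightarrow> T (butlast cs ! i) = butlast cs ! (length (butlast cs) - 1 - i)"
    "\<And>x. x \<notin> set (butlast cs) \<Longrightarrow> T x = x"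
    using list_reversal_matching[OF distinct_butlast[OF assms(1)]] by metis
  have S0: "S (cs ! 0) = cs ! 0"
    using assms by (intro S(3)) (cases cs; auto)
  have S1: "S (cs ! j) = cs ! (?m - j)" if "0 < j" "j < ?m" for j
  proof -
    have "j - 1 < length (tl cs)" "?m - j = Suc (length (tl cs) - 1 - (j - 1))" "j = Suc (j - 1)"
      "length (tl cs) - 1 - (j - 1) < length (tl cs)"
      using that by auto
    then show ?thesis
      using S(2)[of "j - 1"] by (metis nth_tl)
  qed
  have T0: "T (cs ! (?m - 1)) = cs ! (?m - 1)"
  proof (rule T(3))
    have "cs = butlast cs @ [cs ! (?m - 1)]"
      using assms(2) by (metis append_butlast_last_id last_conv_nth)
    then have "distinct (butlast cs @ [cs ! (?m - 1)])"
      using assms(1) by metis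
    then show "cs ! (?m - 1) \<notin> set (butlast cs)"
      by simp
  qed
  have T1: "T (cs ! i) = cs ! (?m - 2 - i)" if "i < ?m - 1" for i
  proof -
    have "length (butlast cs) - 1 - i = ?m - 2 - i" "?m - 2 - i < length (butlast cs)"
      "i < length (butlast cs)"
      using that by auto
    then show ?thesis
      using T(2)[of i] by (metis nth_butlast)
  qed
  have next_elem: "cycle_of_list cs (cs ! i) = (if i = ?m - 1 then cs ! 0 else cs ! Suc i)"
    if "i < ?m" for i
    using cycle_of_list_nth[OF assms(1) that] that by (cases "Suc i = ?m") auto
  have "cycle_of_list cs x = (S \<circ> R) x \<and> cycle_of_list cs x = (R \<circ> T) x" for x
  proof (cases "x \<in> set cs")
    case False
    then have "x \<notin> set (tl cs)" "x \<notin> set (butlast cs)"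
      using assms(2) by (auto dest: list.set_sel(2) in_set_butlastD)
    with False show ?thesis
      using R(3) S(3) T(3) id_outside_supp[OF False] by simp
  next
    case True
    then obtain i where i: "i < ?m" "x = cs ! i"
      by (auto simp: in_set_conv_nth)
    show ?thesis
    proof (cases "i = ?m - 1")
      case True
      then show ?thesis
        using R(2)[of i] i S0 T0 next_elem[of i] by simp
    next
      case False
      then have "0 < ?m - 1 - i" "?m - 1 - i < ?m" "?m - (?m - 1 - i) = Suc i" "i < ?m - 1"
        "?m - 2 - i < ?m" "?m - 1 - (?m - 2 - i) = Suc i"
        using i by auto
      then show ?thesis
        using R(2)[of i] R(2)[of "?m - 2 - i"] S1[of "?m - 1 - i"] T1[of i] next_elem[of i] False i
        by simp
    qed
  qed
  then have "cycle_of_list cs = S \<circ> R" "cycle_of_list cs = R \<circ> T"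
    by blast+
  moreover have "perm_support R \<subseteq> set cs" "perm_support S \<subseteq> set cs" "perm_support T \<subseteq> set cs"
    using R(3) S(3) T(3) assms(2)
    by (auto simp: perm_support_def dest: list.set_sel(2) in_set_butlastD)
  ultimately show ?thesis
    using that[of R S T] R(1) S(1) T(1) by simp
qed

lemma transp_length_cycle_comp:
  assumes "distinct cs" "permutation p" "\<And>x. x \<in> set cs \<Longrightarrow> p x = x"
  shows "transp_length (cycle_of_list cs \<circ> p) = length cs - 1 + transp_length p"
  using assms(1,3)
proof (induction cs rule: cycle_of_list.induct)
  case (1 i j cs)
  let ?v = "cycle_of_list (j # cs) \<circ> p"
  have "?v i = i"
    using 1 by (simp add: id_outside_supp)
  moreover have "permutation ?v"
    using assms(2) by (intro permutation_compose permutation_of_cycle)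
  ultimately have "transp_length (transpose i j \<circ> ?v) = Suc (transp_length ?v)"
    using 1 by (intro transp_length_transpose_comp) auto
  moreover have "transp_length ?v = length (j # cs) - 1 + transp_length p"
    using 1 by (intro "1.IH") auto
  ultimately show ?case
    by (simp only: cycle_of_list.simps comp_assoc) simp
qed (simp_all only: cycle_of_list.simps id_comp list.size diff_0_eq_0 add_0
    add_diff_cancel_right' One_nat_def diff_Suc_Suc)

text \<open>
  The reflections of disjoint cycles commute, so the factorisations of the cycles multiply to
  one of the whole permutation. A cycle of even length is factorised in the order that evens
  out the surplus left by the cycles before it; hence the sizes of the two matchings differ
  by at most one.
\<close>
lemma cycle_decomp_two_matchings:
  assumes "cycle_decomp I p"
  shows "\<exists>\<tau> \<sigma> a b. p = \<tau> \<circ> \<sigma> \<and> matching a \<tau> \<and> matching b \<sigma> \<and>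
    perm_support \<tau> \<subseteq> I \<and> perm_support \<sigma> \<subseteq> I \<and> transp_length p = a + b \<and> b \<le> a \<and> a \<le> b + 1"
  using assms
proof induction
  case empty
  have "id = id \<circ> id" "perm_support id \<subseteq> {}"
    by (auto simp: perm_support_def)
  then show ?case
    using matching_id transp_length_id by (metis add_0 le_refl zero_le)
next
  case (comp I p cs)
  then obtain \<tau> \<sigma> a b where p: "p = \<tau> \<circ> \<sigma>" "matching a \<tau>" "matching b \<sigma>"
    "perm_support \<tau> \<subseteq> I" "perm_support \<sigma> \<subseteq> I" "transp_length p = a + b" "b \<le> a" "a \<le> b + 1"
    by blast
  show ?case
  proof (cases "cs = []")
    case True
    then have "cycle_of_list cs \<circ> p = p" "set cs \<union> I = I"
      by auto
    then show ?thesis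
      using comp.IH by simp
  next
    case False
    let ?m = "length cs"
    have m: "?m \<ge> 1"
      using False by (cases cs) auto
    have "\<exists>\<tau>' \<sigma>' a' b'. cycle_of_list cs = \<tau>' \<circ> \<sigma>' \<and> matching a' \<tau>' \<and> matching b' \<sigma>' \<and>
      perm_support \<tau>' \<subseteq> set cs \<and> perm_support \<sigma>' \<subseteq> set cs \<and> a' + b' = ?m - 1 \<and>
      b + b' \<le> a + a' \<and> a + a' \<le> b + b' + 1"
    proof -
      obtain R S T where RST: "matching (?m div 2) R" "matching ((?m - 1) div 2) S"
        "matching ((?m - 1) div 2) T" "cycle_of_list cs = S \<circ> R" "cycle_of_list cs = R \<circ> T"
        "perm_support R \<subseteq> set cs" "perm_support S \<subseteq> set cs" "perm_support T \<subseteq> set cs"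
        using cycle_eq_comp_matchings[OF comp.hyps(2) False] .
      have half: "?m div 2 + (?m - 1) div 2 = ?m - 1" "(?m - 1) div 2 \<le> ?m div 2"
        "?m div 2 \<le> (?m - 1) div 2 + 1"
        using m by linarith+
      show ?thesis
      proof (cases "a = b")
        case True
        \<comment> \<open>No surplus so far: the larger involution goes to the left.\<close>
        show ?thesis
          by (intro exI conjI, rule RST(5), rule RST(1), rule RST(3), rule RST(6), rule RST(8))
            (use half True in simp_all)
      next
        case False
        \<comment> \<open>The surplus is on the left: the larger involution goes to the right.\<close>
        then have "a = b + 1"
          using p(7,8) by simp
        show ?thesis
          by (intro exI conjI, rule RST(4), rule RST(2), rule RST(1), rule RST(7), rule RST(6))
            (use half \<open>a = b + 1\<close> in simp_all)
      qed
    qed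
    then obtain \<tau>' \<sigma>' a' b' where c: "cycle_of_list cs = \<tau>' \<circ> \<sigma>'" "matching a' \<tau>'" "matching b' \<sigma>'"
      "perm_support \<tau>' \<subseteq> set cs" "perm_support \<sigma>' \<subseteq> set cs" "a' + b' = ?m - 1"
      "b + b' \<le> a + a'" "a + a' \<le> b + b' + 1"
      by blast
    have disj: "f x = x \<or> g x = x" if "perm_support f \<subseteq> set cs" "perm_support g \<subseteq> I" for f g x
      using that comp.hyps(3) unfolding perm_support_def by blast
    have commute: "\<sigma>' \<circ> \<tau> = \<tau> \<circ> \<sigma>'"
    proof
      fix x
      have fg: "g (f y) = f y"
        if "perm_support f \<subseteq> A" "perm_support g \<subseteq> B" "A \<inter> B = {}" "f y \<noteq> y" "f (f y) = y"
        for f g :: "'a \<Rightarrow> 'a" and y A B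
        using that unfolding perm_support_def
        by (metis (mono_tags, lifting) disjoint_iff mem_Collect_eq subsetD)
      show "(\<sigma>' \<circ> \<tau>) x = (\<tau> \<circ> \<sigma>') x"
        using disj[OF c(5) p(4), of x] fg[OF c(5) p(4) comp.hyps(3), of x]
          fg[OF p(4) c(5) , of x] comp.hyps(3) matching_involution[OF p(2), of x]
          matching_involution[OF c(3), of x] by (cases "\<tau> x = x"; cases "\<sigma>' x = x") (auto simp: Int_commute)
    qed
    have "cycle_of_list cs \<circ> p = \<tau>' \<circ> (\<sigma>' \<circ> \<tau>) \<circ> \<sigma>"
      unfolding c(1) p(1) by (simp only: comp_assoc)
    also have "\<dots> = (\<tau>' \<circ> \<tau>) \<circ> (\<sigma>' \<circ> \<sigma>)"
      unfolding commute by (simp only: comp_assoc)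
    finally have eq: "cycle_of_list cs \<circ> p = (\<tau>' \<circ> \<tau>) \<circ> (\<sigma>' \<circ> \<sigma>)" .
    have m: "matching (a' + a) (\<tau>' \<circ> \<tau>)" "matching (b' + b) (\<sigma>' \<circ> \<sigma>)"
      using disj c p by (auto intro!: matching_comp simp del: comp_apply)
    have supp: "perm_support (f' \<circ> f) \<subseteq> set cs \<union> I"
      if "perm_support f' \<subseteq> set cs" "perm_support f \<subseteq> I" for f f' :: "'a \<Rightarrow> 'a"
      using that perm_support_comp[of f' f] by blast
    have len: "transp_length (cycle_of_list cs \<circ> p) = (a' + a) + (b' + b)"
    proof -
      have "permutation p"
        using p(1-3) matching_swapidseq permutation_def permutation_compose by blast
      moreover have "p x = x" if "x \<in> set cs" for x
      proof -
        have "x \<notin> I"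
          using that comp.hyps(3) by blast
        then show ?thesis
          using p(4,5) unfolding p(1) perm_support_def by (metis (mono_tags, lifting) comp_apply mem_Collect_eq subsetD)
      qed
      ultimately show ?thesis
        using transp_length_cycle_comp[OF comp.hyps(2)] c(6) p(6) by simp
    qed
    show ?thesis
      by (intro exI conjI, rule eq, rule m, rule m, rule supp[OF c(4) p(4)],
          rule supp[OF c(5) p(5)], rule len) (use c(7,8) in simp_all)
  qed
qed

lemma permutes_eq_comp_matchings:
  assumes "finite X" "p permutes X"
  obtains \<tau> \<sigma> a b where "p = \<tau> \<circ> \<sigma>" "matching a \<tau>" "matching b \<sigma>"
    "perm_support \<tau> \<subseteq> X" "perm_support \<sigma> \<subseteq> X" "transp_length p = a + b" "b \<le> a" "a \<le> b + 1"
  using cycle_decomp_two_matchings[OF cycle_decomposition[OF assms(2,1)]] by blast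

section \<open>Products of a fixed number of k-transpositions\<close>

primrec k_products :: "nat \<Rightarrow> nat \<Rightarrow> nat \<Rightarrow> (nat \<Rightarrow> nat) set" where
  "k_products k n 0 = {id}"
| "k_products k n (Suc r) = {h \<circ> u | h u. h \<in> k_transpositions k n \<and> u \<in> k_products k n r}"

lemma k_transpositions_comp_cancel:
  assumes "h \<in> k_transpositions k n"
  shows "h \<circ> (h \<circ> u) = u"
proof -
  have "matching k h"
    using assms by (simp add: k_transpositions_iff_matching)
  from matching_involution[OF this] show ?thesis
    by (simp add: fun_eq_iff)
qed

lemma Sym_comp: "p \<in> Sym n \<Longrightarrow> q \<in> Sym n \<Longrightarrow> p \<circ> q \<in> Sym n"
  unfolding Sym_def by (auto intro: permutes_compose simp del: comp_apply)

lemma k_transpositions_Sym: "h \<in> k_transpositions k n \<Longrightarrow> h \<in> Sym n"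
  using k_transpositions_subset_Sym by blast

lemma k_products_sound:
  "u \<in> k_products k n r \<Longrightarrow> u \<in> Sym n \<and> swapidseq (r * k) u"
proof (induction r arbitrary: u)
  case 0
  then have "u = id"
    by simp
  then show ?case
    using permutes_id by (simp only: Sym_def mem_Collect_eq mult_0 swapidseq.id simp_thms)
next
  case (Suc r)
  then obtain h w where u: "u = h \<circ> w" "h \<in> k_transpositions k n" "w \<in> k_products k n r"
    by auto
  have "swapidseq k h"
    using u(2) by (simp add: k_transpositions_iff_matching matching_swapidseq)
  then have "swapidseq (k + r * k) (h \<circ> w)"
    using Suc.IH[OF u(3)] by (intro swapidseq_comp_add) auto
  moreover have "h \<circ> w \<in> Sym n"
    using Suc.IH[OF u(3)] u(2) k_transpositions_Sym Sym_comp by blast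
  ultimately show ?case
    unfolding u(1) mult_Suc by blast
qed

lemma Sym_two_matchings:
  assumes "u \<in> Sym n"
  obtains \<tau> \<sigma> a b where "u = \<tau> \<circ> \<sigma>" "matching a \<tau>" "matching b \<sigma>"
    "perm_support \<tau> \<subseteq> {1..n}" "perm_support \<sigma> \<subseteq> {1..n}"
    "transp_length u = a + b" "b \<le> a" "a \<le> b + 1"
  using assms permutes_eq_comp_matchings[of "{1..n}" u] unfolding Sym_def by blast

lemma matching_exists_avoiding:
  assumes "finite Y" "card Y + 2 * j \<le> n"
  obtains \<rho> where "matching j \<rho>" "perm_support \<rho> \<subseteq> {1..n}" "perm_support \<rho> \<inter> Y = {}"
proof -
  have "card {1..n} - card Y \<le> card ({1..n} - Y)"
    using assms(1) by (rule diff_card_le_card_Diff)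
  then have "2 * j \<le> card ({1..n} - Y)"
    using assms(2) by simp
  then obtain \<rho> where "matching j \<rho>" "\<And>x. x \<notin> {1..n} - Y \<Longrightarrow> \<rho> x = x"
    using matching_exists[of "{1..n} - Y" j] by blast
  then show ?thesis
    using that[of \<rho>] unfolding perm_support_def by blast
qed

text \<open>
  For even length the two matchings of \<open>u\<close> have the same size \<open>a \<le> k\<close>. They cover at most \<open>4a\<close>
  points, so \<open>n \<ge> 4k\<close> leaves room for a common matching \<open>\<rho>\<close> of size \<open>k - a\<close> on the remaining points,
  and \<open>\<rho>\<close> cancels in \<open>(\<tau>\<rho>)(\<rho>\<sigma>)\<close>.
\<close>
lemma two_k_transpositions:
  assumes "4 * k \<le> n" "u \<in> Sym n" "transp_length u \<le> 2 * k" "even (transp_length u)"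
  obtains h h' where "h \<in> k_transpositions k n" "h' \<in> k_transpositions k n" "u = h \<circ> h'"
proof -
  obtain \<tau> \<sigma> a b where u: "u = \<tau> \<circ> \<sigma>" "matching a \<tau>" "matching b \<sigma>"
    "perm_support \<tau> \<subseteq> {1..n}" "perm_support \<sigma> \<subseteq> {1..n}"
    "transp_length u = a + b" "b \<le> a" "a \<le> b + 1"
    using Sym_two_matchings[OF assms(2)] .
  have "even (a + b)"
    using u(6) assms(4) by simp
  then have ab: "a = b" "a \<le> k"
    using assms(3) u(6-8) by presburger+
  let ?Y = "perm_support \<tau> \<union> perm_support \<sigma>"
  have "card ?Y \<le> 4 * a"
    using card_Un_le[of "perm_support \<tau>" "perm_support \<sigma>"] ab
      card_perm_support_matching[OF u(2)] card_perm_support_matching[OF u(3)] by simp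
  then have "card ?Y + 2 * (k - a) \<le> n"
    using ab assms(1) by linarith
  moreover have "finite ?Y"
    using card_perm_support_matching[OF u(2)] card_perm_support_matching[OF u(3)] by simp
  ultimately obtain \<rho> where \<rho>: "matching (k - a) \<rho>" "perm_support \<rho> \<subseteq> {1..n}"
    "perm_support \<rho> \<inter> ?Y = {}"
    using matching_exists_avoiding[of ?Y "k - a" n] by metis
  have "\<tau> x = x \<or> \<rho> x = x" "\<rho> x = x \<or> \<sigma> x = x" for x
    using \<rho>(3) unfolding perm_support_def by blast+
  then have m: "matching (a + (k - a)) (\<tau> \<circ> \<rho>)" "matching ((k - a) + b) (\<rho> \<circ> \<sigma>)"
    using u \<rho> by (blast intro: matching_comp)+
  have "perm_support (\<tau> \<circ> \<rho>) \<subseteq> {1..n}" "perm_support (\<rho> \<circ> \<sigma>) \<subseteq> {1..n}"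
    using perm_support_comp[of \<tau> \<rho>] perm_support_comp[of \<rho> \<sigma>] u \<rho> by blast+
  with m have k: "\<tau> \<circ> \<rho> \<in> k_transpositions k n" "\<rho> \<circ> \<sigma> \<in> k_transpositions k n"
    using ab by (simp_all add: k_transpositions_iff_matching)
  have "u = (\<tau> \<circ> \<rho>) \<circ> (\<rho> \<circ> \<sigma>)"
    unfolding u(1) using matching_involution[OF \<rho>(1)] by (simp add: fun_eq_iff)
  with k show ?thesis
    using that by blast
qed

text \<open>
  If the larger matching \<open>\<tau>\<close> of \<open>u = \<tau>\<sigma>\<close> has at least \<open>k\<close> edges, then \<open>k\<close> of them can be split off, and
  the length drops by \<open>k\<close>. Otherwise all of \<open>\<tau>\<close> is split off, filled up with disjoint
  transpositions; what remains consists of the filling and \<open>\<sigma>\<close>, which is not larger than \<open>\<tau>\<close>, hence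
  of at most \<open>k\<close> transpositions.
\<close>
lemma peel_k_transposition:
  assumes "2 * k \<le> n" "u \<in> Sym n"
  obtains h w c where "h \<in> k_transpositions k n" "w \<in> Sym n" "u = h \<circ> w"
    "swapidseq c w" "c \<le> max k (transp_length u - k)"
proof -
  obtain \<tau> \<sigma> a b where u: "u = \<tau> \<circ> \<sigma>" "matching a \<tau>" "matching b \<sigma>"
    "perm_support \<tau> \<subseteq> {1..n}" "perm_support \<sigma> \<subseteq> {1..n}"
    "transp_length u = a + b" "b \<le> a" "a \<le> b + 1"
    using Sym_two_matchings[OF assms(2)] .
  have "\<exists>h c. h \<in> k_transpositions k n \<and> swapidseq c (h \<circ> u) \<and> c \<le> max k (transp_length u - k)"
  proof (cases "k \<le> a")
    case True
    then have "matching (k + (a - k)) \<tau>"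
      using u(2) by simp
    from matching_split[OF this] obtain h \<tau>' where h: "matching k h" "matching (a - k) \<tau>'"
      "\<tau> = h \<circ> \<tau>'" "\<And>x. \<tau> x = x \<Longrightarrow> h x = x"
      by metis
    have "h \<in> k_transpositions k n"
      using h(1,4) u(4) by (auto simp: k_transpositions_iff_matching perm_support_def)
    moreover have "h \<circ> u = \<tau>' \<circ> \<sigma>"
      using matching_involution[OF h(1)] unfolding u(1) h(3) by (simp add: fun_eq_iff)
    moreover have "swapidseq ((a - k) + b) (\<tau>' \<circ> \<sigma>)"
      using h(2) u(3) by (intro swapidseq_comp_add matching_swapidseq)
    moreover have "(a - k) + b \<le> max k (transp_length u - k)"
      using True u(6) by simp
    ultimately show ?thesis
      by metis
  next
    case False
    have fin: "finite (perm_support \<tau>)" "card (perm_support \<tau>) = 2 * a"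
      using card_perm_support_matching[OF u(2)] .
    moreover have "2 * a + 2 * (k - a) \<le> n"
      using False assms(1) by simp
    ultimately obtain \<rho> where \<rho>: "matching (k - a) \<rho>" "perm_support \<rho> \<subseteq> {1..n}"
      "perm_support \<rho> \<inter> perm_support \<tau> = {}"
      using matching_exists_avoiding[of "perm_support \<tau>" "k - a" n] by metis
    have "matching ((k - a) + a) (\<rho> \<circ> \<tau>)"
      using \<rho>(3) unfolding perm_support_def by (intro matching_comp \<rho>(1) u(2)) blast
    moreover have "perm_support (\<rho> \<circ> \<tau>) \<subseteq> {1..n}"
      using perm_support_comp[of \<rho> \<tau>] \<rho>(2) u(4) by blast
    ultimately have "\<rho> \<circ> \<tau> \<in> k_transpositions k n"
      using False by (simp add: k_transpositions_iff_matching)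
    moreover have "\<rho> \<circ> \<tau> \<circ> u = \<rho> \<circ> \<sigma>"
      using matching_involution[OF u(2)] unfolding u(1) by (simp add: fun_eq_iff)
    moreover have "swapidseq ((k - a) + b) (\<rho> \<circ> \<sigma>)"
      using \<rho>(1) u(3) by (intro swapidseq_comp_add matching_swapidseq)
    moreover have "(k - a) + b \<le> max k (transp_length u - k)"
      using False u(7) by simp
    ultimately show ?thesis
      by metis
  qed
  then obtain h c where h: "h \<in> k_transpositions k n" "swapidseq c (h \<circ> u)"
    "c \<le> max k (transp_length u - k)"
    by blast
  show ?thesis
  proof (rule that)
    show "h \<circ> u \<in> Sym n"
      using h(1) assms(2) k_transpositions_Sym Sym_comp by blast
    show "u = h \<circ> (h \<circ> u)"
      by (rule k_transpositions_comp_cancel[OF h(1), symmetric])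
  qed (use h in auto)
qed

text \<open>
  Apart from parity, the length is the only obstruction to being a product of \<open>r\<close> \<open>k\<close>-transpositions.
  Two factors are the base of the induction; each further factor is peeled off, where the
  bound \<open>max k (transp_length u - k)\<close> for the rest is at most \<open>r k\<close> as soon as \<open>r \<ge> 1\<close>. A single factor
  is not enough: for \<open>k \<ge> 2\<close> the cycles of length \<open>k + 1\<close> have transposition length \<open>k\<close>.
\<close>
theorem k_products_eq:
  assumes "4 * k \<le> n" "2 \<le> r"
  shows "k_products k n r = {u \<in> Sym n. transp_length u \<le> r * k \<and> even (transp_length u + r * k)}"
proof
  show "k_products k n r \<subseteq> {u \<in> Sym n. transp_length u \<le> r * k \<and> even (transp_length u + r * k)}"
    using k_products_sound transp_length_le even_transp_length even_add by blast
  have "u \<in> k_products k n r"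
    if "u \<in> Sym n" "transp_length u \<le> r * k" "even (transp_length u + r * k)" for u
    using assms(2) that
  proof (induction r arbitrary: u rule: dec_induct)
    case base
    then have "transp_length u \<le> 2 * k" "even (transp_length u)"
      by simp_all
    from two_k_transpositions[OF assms(1) base(1) this] obtain h h'
      where h: "h \<in> k_transpositions k n" "h' \<in> k_transpositions k n" "u = h \<circ> h'"
      by blast
    have "h' \<in> k_products k n (Suc 0)"
      using h(2) by auto
    then have "u \<in> k_products k n (Suc (Suc 0))"
      unfolding k_products.simps(2)[of k n "Suc 0"] using h by blast
    then show ?case
      by (simp only: numeral_2_eq_2)
  next
    case (step r)
    have "2 * k \<le> n"
      using assms(1) by simp
    then obtain h w c where h: "h \<in> k_transpositions k n" "w \<in> Sym n" "u = h \<circ> w"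
      "swapidseq c w" "c \<le> max k (transp_length u - k)"
      using peel_k_transposition step.prems(1) by blast
    have "swapidseq (k + c) u"
      unfolding h(3) using h(1,4)
      by (intro swapidseq_comp_add) (simp_all add: k_transpositions_iff_matching matching_swapidseq)
    then have "even (transp_length u) = even (k + c)"
      by (rule even_transp_length)
    moreover have "even (transp_length w) = even c"
      using h(4) by (rule even_transp_length)
    ultimately have "even (transp_length w + r * k)"
      using step.prems(3) by auto
    moreover have "transp_length w \<le> r * k"
    proof -
      have "transp_length u - k \<le> r * k"
        using step.prems(2) by simp
      moreover have "k \<le> r * k"
        using step.hyps by simp
      ultimately have "max k (transp_length u - k) \<le> r * k"
        by (rule max.boundedI[rotated])
      then show ?thesis
        using transp_length_le[OF h(4)] h(5) by (meson order_trans)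
    qed
    ultimately have "w \<in> k_products k n r"
      using step.IH h(2) by blast
    then show ?case
      unfolding k_products.simps(2) using h(1,3) by blast
  qed
  then show "{u \<in> Sym n. transp_length u \<le> r * k \<and> even (transp_length u + r * k)} \<subseteq> k_products k n r"
    by blast
qed

section \<open>Balls of the Cayley graph\<close>

text \<open>
  Walking along an arc multiplies by a \<open>k\<close>-transposition on the right, and every such
  multiplication is an arc: as \<open>k \<ge> 1\<close>, it moves a point, and so the two vertices differ.
\<close>
lemma awalk_iff_k_products:
  assumes "1 \<le> k" "g \<in> Sym n"
  shows "(\<exists>p. pre_digraph.awalk (with_proj (transposition_graph k n)) g p u \<and> length p = j) \<longleftrightarrow>
    (\<exists>w \<in> k_products k n j. u = g \<circ> w)"
proof -
  let ?G = "with_proj (transposition_graph k n)"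
  interpret wf_digraph ?G
    by (rule wf_transposition_graph)
  have arc: "(g, v) \<in> arcs ?G \<longleftrightarrow> (\<exists>h \<in> k_transpositions k n. v = g \<circ> h)" if g: "g \<in> Sym n" for g v
  proof
    assume "\<exists>h \<in> k_transpositions k n. v = g \<circ> h"
    then obtain h where h: "h \<in> k_transpositions k n" "v = g \<circ> h" by blast
    have "card (perm_support h) = 2 * k"
      using h(1) card_perm_support_matching(2) unfolding k_transpositions_iff_matching by blast
    then have "perm_support h \<noteq> {}"
      using assms(1) by auto
    then obtain x where "h x \<noteq> x"
      unfolding perm_support_def by blast
    moreover have "inj g"
      using g unfolding Sym_def by (auto intro: permutes_inj)
    ultimately have "v x \<noteq> g x"
      unfolding h(2) by (simp add: inj_eq)
    then have "g \<noteq> v" by auto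
    then show "(g, v) \<in> arcs ?G"
      using h g Sym_comp[OF g k_transpositions_Sym[OF h(1)]]
      unfolding with_proj_simps transposition_graph_def by auto
  qed (auto simp: transposition_graph_def)
  show ?thesis
    using assms(2)
  proof (induction j arbitrary: g)
    case 0
    then have "g \<in> verts ?G"
      by (simp add: transposition_graph_def)
    then show ?case
      by (auto simp: awalk_Nil_iff)
  next
    case (Suc j)
    have "(\<exists>p. awalk g p u \<and> length p = Suc j) \<longleftrightarrow>
      (\<exists>v. (g, v) \<in> arcs ?G \<and> (\<exists>p. awalk v p u \<and> length p = j))"
    proof
      assume "\<exists>p. awalk g p u \<and> length p = Suc j"
      then obtain e es where "awalk g (e # es) u" "length es = j"
        by (metis length_Suc_conv)
      then have "(g, snd e) \<in> arcs ?G \<and> awalk (snd e) es u \<and> length es = j"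
        unfolding awalk_Cons_iff with_proj_simps by (metis prod.collapse)
      then show "\<exists>v. (g, v) \<in> arcs ?G \<and> (\<exists>p. awalk v p u \<and> length p = j)"
        by blast
    next
      assume "\<exists>v. (g, v) \<in> arcs ?G \<and> (\<exists>p. awalk v p u \<and> length p = j)"
      then obtain v p where "(g, v) \<in> arcs ?G" "awalk v p u" "length p = j"
        by blast
      then have "awalk g ((g, v) # p) u \<and> length ((g, v) # p) = Suc j"
        by (simp add: awalk_Cons_iff)
      then show "\<exists>p. awalk g p u \<and> length p = Suc j"
        by blast
    qed
    also have "\<dots> \<longleftrightarrow> (\<exists>h \<in> k_transpositions k n. \<exists>p. awalk (g \<circ> h) p u \<and> length p = j)"
      unfolding arc[OF Suc.prems] by blast
    also have "\<dots> \<longleftrightarrow> (\<exists>h \<in> k_transpositions k n. \<exists>w \<in> k_products k n j. u = (g \<circ> h) \<circ> w)"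
      using Suc.IH Sym_comp[OF Suc.prems k_transpositions_Sym] by blast
    also have "\<dots> \<longleftrightarrow> (\<exists>w \<in> k_products k n (Suc j). u = g \<circ> w)"
      unfolding k_products.simps(2) comp_assoc by blast
    finally show ?case .
  qed
qed

text \<open>
  The costs of walks are natural numbers, so an infimum below \<open>r + 1\<close> is already attained by a
  walk of length at most \<open>r\<close>.
\<close>
lemma graph_dist_le_iff:
  "wf_digraph (with_proj G) \<Longrightarrow> graph_dist G u v \<le> ereal (real r) \<longleftrightarrow>
    (\<exists>p. pre_digraph.awalk (with_proj G) u p v \<and> length p \<le> r)"
proof -
  assume "wf_digraph (with_proj G)"
  then interpret wf_digraph "with_proj G" .
  have cost: "awalk_cost (\<lambda>_. 1) p = real (length p)" for p :: "('a \<times> 'a) list"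
    by (induction p) (simp_all add: awalk_cost_def)
  show ?thesis
  proof
    assume "graph_dist G u v \<le> ereal (real r)"
    also have "\<dots> < ereal (real (Suc r))"
      by simp
    finally obtain p where "awalk u p v" "ereal (awalk_cost (\<lambda>_. 1) p) < ereal (real (Suc r))"
      unfolding graph_dist_def \<mu>_def INF_less_iff by blast
    then show "\<exists>p. awalk u p v \<and> length p \<le> r"
      unfolding cost by (intro exI[of _ p]) simp
  next
    assume "\<exists>p. awalk u p v \<and> length p \<le> r"
    then obtain p where "awalk u p v" "length p \<le> r"
      by blast
    then have "\<mu> (\<lambda>_. 1) u v \<le> ereal (real (length p))"
      using min_cost_le_walk_cost[of u p v "\<lambda>_. 1"] unfolding cost by blast
    also have "\<dots> \<le> ereal (real r)"
      using \<open>length p \<le> r\<close> by simp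
    finally show "graph_dist G u v \<le> ereal (real r)"
      unfolding graph_dist_def .
  qed
qed

text \<open>
  The lengths that occur in a ball of radius \<open>r\<close>, where \<open>d\<close> stands for \<open>r k\<close>: those of products of \<open>r\<close>
  factors or of \<open>r - 1\<close> factors. The parameter \<open>d\<close> is an arbitrary integer because the
  recursion in \<open>n\<close> passes from \<open>d\<close> to \<open>d - 1\<close>, which need not be a multiple of \<open>k\<close>.
\<close>
definition ball_length :: "nat \<Rightarrow> int \<Rightarrow> nat \<Rightarrow> bool" where
  "ball_length k d l \<longleftrightarrow> int l \<le> d \<and> even (d - int l) \<or> int l \<le> d - int k \<and> even (d - int k - int l)"

text \<open>
  Products of \<open>j \<le> r\<close> factors have the parity of \<open>r\<close> or that of \<open>r - 1\<close> factors and are no longer than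
  those. Conversely, \<open>r \<ge> 3\<close> makes both \<open>r\<close> and \<open>r - 1\<close> large enough for the description of
  products by length and parity.
\<close>
lemma graph_ball_eq:
  assumes "1 \<le> k" "4 * k \<le> n" "3 \<le> r" "g \<in> Sym n"
  shows "graph_ball (transposition_graph k n) r g =
    {u \<in> Sym n. ball_length k (int r * int k) (transp_length (inv g \<circ> u))}"
proof -
  let ?G = "transposition_graph k n"
  have "graph_dist ?G g u \<le> ereal (real r) \<longleftrightarrow>
    ball_length k (int r * int k) (transp_length (inv g \<circ> u))" if u: "u \<in> Sym n" for u
  proof -
    have g: "bij g"
      using assms(4) unfolding Sym_def by (auto intro: permutes_bij)
    let ?w = "inv g \<circ> u"
    have w: "?w \<in> Sym n"
      using assms(4) u Sym_comp permutes_inv unfolding Sym_def by blast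
    have uw: "u = g \<circ> v \<longleftrightarrow> v = ?w" for v
      using g by (auto simp add: fun_eq_iff bij_inv_eq_iff bij_is_surj surj_f_inv_f bij_is_inj)
    have "graph_dist ?G g u \<le> ereal (real r) \<longleftrightarrow> (\<exists>j \<le> r. ?w \<in> k_products k n j)"
      using graph_dist_le_iff[OF wf_transposition_graph, of k n g u r]
        awalk_iff_k_products[OF assms(1,4), of u] uw by metis
    also have "\<dots> \<longleftrightarrow> ball_length k (int r * int k) (transp_length ?w)"
    proof
      assume "\<exists>j \<le> r. ?w \<in> k_products k n j"
      then obtain j where j: "j \<le> r" "?w \<in> k_products k n j"
        by blast
      define l where "l = transp_length ?w"
      have l: "l \<le> j * k" "even l \<longleftrightarrow> even (j * k)"
        using k_products_sound[OF j(2)] transp_length_le even_transp_length unfolding l_def by blast+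
      show "ball_length k (int r * int k) (transp_length ?w)"
      proof (cases "even (r - j)")
        case True
        have "j * k \<le> r * k"
          using j(1) by simp
        then have "int l \<le> int r * int k"
          using l(1) by (metis of_nat_le_iff of_nat_mult order_trans)
        moreover have "even (int r * int k - int l)"
          using True l(2) j(1) by auto
        ultimately show ?thesis
          unfolding ball_length_def l_def by blast
      next
        case False
        then have "j + 1 \<le> r"
          using j(1) by (cases "j = r") auto
        then have "(j + 1) * k \<le> r * k"
          by (intro mult_right_mono) auto
        then have "l + k \<le> r * k"
          using l(1) by simp
        then have "int l \<le> int r * int k - int k"
          by (metis le_diff_eq of_nat_add of_nat_le_iff of_nat_mult)
        moreover have "even (int r * int k - int k - int l)"
          using False l(2) j(1) by auto
        ultimately show ?thesis
          unfolding ball_length_def l_def by blast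
      qed
    next
      assume ball: "ball_length k (int r * int k) (transp_length ?w)"
      have "?w \<in> k_products k n j"
        if "2 \<le> j" "int (transp_length ?w) \<le> int j * int k" "even (int j * int k - int (transp_length ?w))" for j
      proof -
        have "transp_length ?w \<le> j * k"
          using that(2) by (metis of_nat_le_iff of_nat_mult)
        moreover have "even (transp_length ?w + j * k)"
          using that(3) by auto
        ultimately show ?thesis
          unfolding k_products_eq[OF assms(2) that(1)] using w by blast
      qed
      note prod = this
      have pred: "int r * int k - int k = int (r - 1) * int k" "2 \<le> r" "2 \<le> r - 1" "r - 1 \<le> r"
        using assms(3) by (simp_all add: of_nat_diff algebra_simps)
      show "\<exists>j \<le> r. ?w \<in> k_products k n j"
        using ball prod[OF pred(2)] prod[OF pred(3)] pred(4)
        unfolding ball_length_def pred(1) by blast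
    qed
    finally show ?thesis .
  qed
  then show ?thesis
    unfolding graph_ball_def transposition_graph_def by auto
qed

section \<open>Counting the intersection of two balls\<close>

definition ball_count :: "nat \<Rightarrow> (nat \<Rightarrow> nat) \<Rightarrow> nat \<Rightarrow> int \<Rightarrow> nat" where
  "ball_count k g n d =
     card {u \<in> Sym n. ball_length k d (transp_length u) \<and> ball_length k d (transp_length (inv g \<circ> u))}"

lemma finite_Sym [simp]: "finite (Sym n)"
  unfolding Sym_def by (simp add: finite_permutations)

text \<open>
  The first alternative for \<open>d - k\<close> is the second one for \<open>d\<close>, and the second alternative for \<open>d - k\<close>
  implies the first one for \<open>d\<close>, because \<open>2k\<close> is even.
\<close>
lemma ball_length_mono: "ball_length k (d - int k) l \<Longrightarrow> ball_length k d l"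
  unfolding ball_length_def by auto

lemma ball_length_Suc: "ball_length k d (Suc l) \<longleftrightarrow> ball_length k (d - 1) l"
proof -
  have "int (Suc l) \<le> d \<longleftrightarrow> int l \<le> d - 1" "d - int (Suc l) = d - 1 - int l"
    "int (Suc l) \<le> d - int k \<longleftrightarrow> int l \<le> d - 1 - int k"
    "d - int k - int (Suc l) = d - 1 - int k - int l"
    by auto
  then show ?thesis
    unfolding ball_length_def by metis
qed

lemma ball_count_mono: "ball_count k g n (d - int k) \<le> ball_count k g n d"
  unfolding ball_count_def by (intro card_mono) (auto dest: ball_length_mono)

lemma ball_count_neg: "d < 0 \<Longrightarrow> ball_count k g n d = 0"
  unfolding ball_count_def by (auto simp: ball_length_def)

lemma permutation_Sym: "p \<in> Sym n \<Longrightarrow> permutation p"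
  unfolding Sym_def by (auto simp: permutation_permutes)

text \<open>
  Each element of \<open>Sym (n + 1)\<close> that moves the new point \<open>n + 1\<close> is uniquely \<open>(n+1 b) q\<close> with \<open>b \<le> n\<close> and
  \<open>q\<close> in \<open>Sym n\<close>. Since \<open>g\<close> fixes the new point, \<open>inv g\<close> turns this product into
  \<open>(n+1 b') (inv g q)\<close> with \<open>b' = inv g b\<close>; so the lengths of the element and of its translate both grow by one.
\<close>
lemma ball_count_Suc:
  assumes g: "g \<in> Sym n"
  shows "ball_count k g (Suc n) d = ball_count k g n d + n * ball_count k g n (d - 1)"
proof -
  let ?N = "Suc n"
  define P where "P d u \<longleftrightarrow> ball_length k d (transp_length u) \<and>
    ball_length k d (transp_length (inv g \<circ> u))" for d and u :: "nat \<Rightarrow> nat"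
  have count: "ball_count k g m d = (\<Sum>u \<in> Sym m. if P d u then 1 else 0)" for m d
    unfolding ball_count_def P_def card_eq_sum by (rule sum.inter_filter) (rule finite_Sym)
  have inv_g: "inv g permutes {1..n}"
    using g permutes_inv unfolding Sym_def by blast
  have step: "P d (transpose ?N b \<circ> q) \<longleftrightarrow> P (d - 1) q" if b: "b \<in> {1..n}" and q: "q \<in> Sym n" for b q
  proof -
    have fixed: "q ?N = ?N" "inv g ?N = ?N" "?N \<noteq> b" "inv g b \<noteq> ?N"
      using q b inv_g permutes_in_image[OF inv_g, of b] unfolding Sym_def
      by (auto intro: permutes_not_in)
    have perm: "permutation q" "permutation (inv g \<circ> q)"
      using permutation_Sym[OF q] permutation_inverse[OF permutation_Sym[OF g]]
      by (auto intro: permutation_compose simp del: comp_apply)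
    have "inv g \<circ> (transpose ?N b \<circ> q) = transpose ?N (inv g b) \<circ> (inv g \<circ> q)"
    proof -
      have "inv g (transpose a b y) = transpose (inv g a) (inv g b) (inv g y)" for a b y
        using permutes_inj[OF inv_g] by (auto simp: transpose_def inj_eq)
      then show ?thesis
        using fixed(2) by (simp add: fun_eq_iff)
    qed
    moreover have "transp_length (transpose ?N b \<circ> q) = Suc (transp_length q)"
      using perm(1) fixed(1,3) by (rule transp_length_transpose_comp)
    moreover have "transp_length (transpose ?N (inv g b) \<circ> (inv g \<circ> q)) = Suc (transp_length (inv g \<circ> q))"
      using perm(2) by (rule transp_length_transpose_comp) (use fixed in simp_all)
    ultimately show ?thesis
      unfolding P_def by (simp only: ball_length_Suc)
  qed
  have "{1..?N} = insert ?N {1..n}"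
    by auto
  then have "ball_count k g ?N d =
      (\<Sum>b \<in> insert ?N {1..n}. \<Sum>q \<in> Sym n. if P d (transpose ?N b \<circ> q) then 1 else 0)"
    unfolding count Sym_def by (simp add: sum_over_permutations_insert)
  also have "\<dots> = (\<Sum>q \<in> Sym n. if P d q then 1 else 0) +
      (\<Sum>b \<in> {1..n}. \<Sum>q \<in> Sym n. if P d (transpose ?N b \<circ> q) then 1 else 0)"
    by simp
  also have "(\<Sum>b \<in> {1..n}. \<Sum>q \<in> Sym n. if P d (transpose ?N b \<circ> q) then 1 else (0::nat)) =
      (\<Sum>b \<in> {1..n}. \<Sum>q \<in> Sym n. if P (d - 1) q then 1 else 0)"
    using step by (intro sum.cong refl) simp
  finally show ?thesis
    unfolding count by simp
qed

text \<open>
  With \<open>m = n - d\<close> the recursion for the counts becomes that of the Stirling numbers of the first kind.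
\<close>
lemma stirling_function_ball_count:
  assumes "g \<in> Sym t"
  shows "stirling_function t (\<lambda>n m. ball_count k g n (int n - m))"
  unfolding stirling_function_def
proof (intro conjI allI impI)
  fix n m assume "t < n"
  then obtain n' where n: "n = Suc n'" "t \<le> n'"
    by (cases n) auto
  have "{1..t} \<subseteq> {1..n'}"
    using n(2) by auto
  then have "g \<in> Sym n'"
    using assms permutes_subset unfolding Sym_def by blast
  moreover have "int n' - (m - 1) = int n - m" "int n' - m = int n - m - 1"
    using n(1) by simp_all
  ultimately show "ball_count k g n (int n - m) =
      ball_count k g (n - 1) (int (n - 1) - (m - 1)) + (n - 1) * ball_count k g (n - 1) (int (n - 1) - m)"
    using ball_count_Suc[of g n' k "int n - m"] unfolding n(1) diff_Suc_1 by metis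
next
  fix n m assume "int n < m"
  then show "ball_count k g n (int n - m) = 0"
    by (intro ball_count_neg) simp
qed

section \<open>Splitting a Stirling function\<close>

text \<open>
  This is \<open>C n m - C n (m + k) + C n (m + 2k) - \<dots>\<close>, where the terms with second argument above \<open>n\<close>
  are left out. The case \<open>k = 0\<close> only serves termination.
\<close>
function alternating_tail :: "nat \<Rightarrow> (nat \<Rightarrow> int \<Rightarrow> nat) \<Rightarrow> nat \<Rightarrow> int \<Rightarrow> nat" where
  "alternating_tail k C n m =
     (if m > int n \<or> k = 0 then 0 else C n m - alternating_tail k C n (m + int k))"
  by auto
termination
  by (relation "measure (\<lambda>(k, C, n, m). nat (int n + 1 - m))") auto

declare alternating_tail.simps [simp del]

text \<open>
  The Stirling recursion is linear and its coefficient does not depend on \<open>m\<close>, so it is inherited by the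
  alternating sum of the shifts of \<open>C\<close> by multiples of \<open>k\<close>. Monotonicity makes the truncated subtractions exact.
\<close>
lemma stirling_function_split:
  assumes C: "stirling_function t C" and "1 \<le> k"
    and mono: "\<And>n m. t \<le> n \<Longrightarrow> C n (m + int k) \<le> C n m"
  obtains F where "stirling_function t F" "\<And>n m. t \<le> n \<Longrightarrow> C n m = F n m + F n (m + int k)"
proof -
  define F where "F = alternating_tail k C"
  have F_gt: "F n m = 0" if "m > int n" for n m
    unfolding F_def using that by (simp add: alternating_tail.simps)
  have F_rec: "F n m = C n m - F n (m + int k)" if "m \<le> int n" for n m
    unfolding F_def using that assms(2) by (subst alternating_tail.simps) simp
  have split: "C n m = F n m + F n (m + int k)" if n: "t \<le> n" for n m
  proof (cases "m > int n")
    case True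
    then show ?thesis
      using n C F_gt[of n m] F_gt[of n "m + int k"] unfolding stirling_function_def by simp
  next
    case False
    have "F n (m + int k) \<le> C n (m + int k)"
      using F_gt[of n "m + int k"] F_rec[of "m + int k" n] by (cases "m + int k > int n") auto
    also have "\<dots> \<le> C n m"
      using n by (rule mono)
    finally show ?thesis
      using F_rec[of m n] False by simp
  qed
  have "F n m = F (n - 1) (m - 1) + (n - 1) * F (n - 1) m" if n: "t < n" for n m
  proof (induction "nat (int n + 1 - m)" arbitrary: m rule: less_induct)
    case less
    show ?case
    proof (cases "m > int n")
      case True
      then show ?thesis
        using n by (simp add: F_gt)
    next
      case False
      then have IH: "F n (m + int k) = F (n - 1) (m + int k - 1) + (n - 1) * F (n - 1) (m + int k)"
        using assms(2) by (intro less) simp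
      have eq: "m - 1 + int k = m + int k - 1"
        by simp
      have n1: "t \<le> n" "t \<le> n - 1"
        using n by auto
      have "F n m + F n (m + int k) = C n m"
        using split[OF n1(1)] by simp
      also have "\<dots> = C (n - 1) (m - 1) + (n - 1) * C (n - 1) m"
        using C n unfolding stirling_function_def by blast
      also have "\<dots> = F (n - 1) (m - 1) + F (n - 1) (m + int k - 1) +
          (n - 1) * (F (n - 1) m + F (n - 1) (m + int k))"
        using split[OF n1(2), of "m - 1"] split[OF n1(2), of m] unfolding eq by simp
      finally show ?thesis
        unfolding IH by (simp add: algebra_simps)
    qed
  qed
  then have "stirling_function t F"
    unfolding stirling_function_def using F_gt by blast
  then show ?thesis
    using that split by blast
qed

section \<open>Independence of the embedding\<close>

lemma bij_betw_extends_to_permutes: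
  assumes "finite X" "P \<subseteq> X" "Q \<subseteq> X" "bij_betw h P Q"
  obtains \<pi> where "\<pi> permutes X" "\<And>x. x \<in> P \<Longrightarrow> \<pi> x = h x"
proof -
  have "card P = card Q"
    using assms(4) by (rule bij_betw_same_card)
  then have "card (X - P) = card (X - Q)"
    using assms(1-3) by (simp add: card_Diff_subset finite_subset)
  then obtain f where f: "bij_betw f (X - P) (X - Q)"
    using assms(1) finite_same_card_bij by blast
  define \<pi> where "\<pi> x = (if x \<in> P then h x else if x \<in> X then f x else x)" for x
  have "bij_betw \<pi> P Q"
    using assms(4) by (rule bij_betw_cong[THEN iffD1, rotated]) (simp add: \<pi>_def)
  moreover have "bij_betw \<pi> (X - P) (X - Q)"
    using f by (rule bij_betw_cong[THEN iffD1, rotated]) (simp add: \<pi>_def)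
  ultimately have "bij_betw \<pi> (P \<union> (X - P)) (Q \<union> (X - Q))"
    by (rule bij_betw_combine) blast
  then have "bij_betw \<pi> X X"
    using assms(2,3) by (simp add: Un_absorb1)
  then have "\<pi> permutes X"
    by (rule bij_imp_permutes) (use assms(2) in \<open>auto simp: \<pi>_def\<close>)
  then show ?thesis
    by (rule that) (simp add: \<pi>_def)
qed

text \<open>
  Conjugation by \<open>\<pi>\<close> permutes \<open>Sym n\<close>, is multiplicative and preserves the transposition length.
\<close>
lemma ball_count_conj:
  assumes "\<pi> \<in> Sym n" "bij g"
  shows "ball_count k (\<pi> \<circ> g \<circ> inv \<pi>) n d = ball_count k g n d"
proof -
  have \<pi>: "bij \<pi>" "inv \<pi> \<in> Sym n"
    using assms(1) permutes_inv permutes_bij unfolding Sym_def by auto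
  have cancel: "inv \<pi> (\<pi> x) = x" "\<pi> (inv \<pi> x) = x" for x
    using \<pi>(1) by (auto simp: bij_is_inj bij_is_surj surj_f_inv_f)
  let ?c = "\<lambda>u. \<pi> \<circ> u \<circ> inv \<pi>"
  have "inv (?c g) = ?c (inv g)"
    using assms(2) \<pi>(1) by (simp add: o_inv_distrib bij_comp bij_imp_bij_inv inv_inv_eq comp_assoc)
  then have conj: "inv (?c g) \<circ> ?c u = ?c (inv g \<circ> u)" for u
    by (simp add: fun_eq_iff cancel)
  have bij: "bij_betw ?c (Sym n) (Sym n)"
    by (rule bij_betw_byWitness[where f' = "\<lambda>u. inv \<pi> \<circ> u \<circ> \<pi>"])
      (use assms(1) \<pi>(2) Sym_comp in \<open>auto simp: fun_eq_iff cancel\<close>)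
  define P where "P h u \<longleftrightarrow> ball_length k d (transp_length u) \<and>
    ball_length k d (transp_length (inv h \<circ> u))" for h u :: "nat \<Rightarrow> nat"
  have P: "P (?c g) (?c u) \<longleftrightarrow> P g u" for u
    unfolding P_def conj by (simp only: transp_length_conj[OF \<pi>(1)])
  have "card {u \<in> Sym n. P g u} = card (?c ` {u \<in> Sym n. P g u})"
    using bij by (intro card_image[symmetric]) (auto simp: bij_betw_def intro: inj_on_subset)
  also have "?c ` {u \<in> Sym n. P g u} = {u \<in> Sym n. P (?c g) u}"
  proof -
    have "?c ` {u \<in> Sym n. P g u} = ?c ` {u \<in> Sym n. P (?c g) (?c u)}"
      unfolding P ..
    also have "\<dots> = {v \<in> ?c ` Sym n. P (?c g) v}"
      by (rule Compr_image_eq[symmetric])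
    finally show ?thesis
      unfolding bij_betw_imp_surj_on[OF bij] .
  qed
  finally show ?thesis
    unfolding ball_count_def P_def by (rule sym)
qed

lemma metric_intersection_eq_ball_count:
  assumes "1 \<le> k" "4 * k \<le> n" "3 \<le> r" "g \<in> Sym n"
  shows "metric_intersection k n r g = ball_count k g n (int r * int k)"
proof -
  have "id \<in> Sym n"
    unfolding Sym_def by (simp only: permutes_id mem_Collect_eq)
  note balls = graph_ball_eq[OF assms(1-3) this] graph_ball_eq[OF assms]
  have "inv id \<circ> u = u" for u :: "nat \<Rightarrow> nat"
    by simp
  then show ?thesis
    unfolding metric_intersection_def ball_count_def balls
    by (intro arg_cong[of _ _ card]) auto
qed

text \<open>
  The bijection between the two images of the support extends to a permutation of \<open>X\<close>.
\<close>
lemma map_permutation_conj: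
  assumes "p permutes S" "inj_on e S" "inj_on \<iota> S" "finite X" "e ` S \<subseteq> X" "\<iota> ` S \<subseteq> X"
  obtains \<pi> where "\<pi> permutes X"
    "map_permutation S \<iota> p = \<pi> \<circ> map_permutation S e p \<circ> inv \<pi>"
proof -
  have "bij_betw (\<iota> \<circ> inv_into S e) (e ` S) (\<iota> ` S)"
    using assms(2,3) by (intro bij_betw_trans[OF bij_betw_inv_into] ) (auto simp: bij_betw_def)
  then obtain \<pi> where \<pi>: "\<pi> permutes X" "\<And>y. y \<in> e ` S \<Longrightarrow> \<pi> y = (\<iota> \<circ> inv_into S e) y"
    using bij_betw_extends_to_permutes[OF assms(4-6)] by blast
  have \<pi>_e: "\<pi> (e x) = \<iota> x" if "x \<in> S" for x
    using \<pi>(2)[of "e x"] that assms(2) by simp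
  let ?p = "map_permutation S \<iota> p" and ?q = "map_permutation S e p"
  have perm: "?p permutes \<iota> ` S" "?q permutes e ` S"
    using assms(1-3) by (auto intro!: map_permutation_permutes simp: bij_betw_def)
  have "?p (\<pi> y) = \<pi> (?q y)" for y
  proof (cases "y \<in> e ` S")
    case True
    then obtain x where x: "x \<in> S" "y = e x" by blast
    moreover have "p x \<in> S"
      using x assms(1) by (simp add: permutes_in_image)
    ultimately show ?thesis
      using assms(2,3) by (simp add: \<pi>_e map_permutation_apply)
  next
    case False
    have "\<pi> y \<notin> \<iota> ` S"
    proof
      assume "\<pi> y \<in> \<iota> ` S"
      then obtain x where "x \<in> S" "\<pi> y = \<pi> (e x)"
        using \<pi>_e by auto
      then show False
        using False permutes_inj[OF \<pi>(1)] by (auto simp: inj_eq)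
    qed
    then show ?thesis
      using False perm permutes_not_in by metis
  qed
  then have "?p = \<pi> \<circ> ?q \<circ> inv \<pi>"
    using permutes_inverses(1)[OF \<pi>(1)] by (auto simp: fun_eq_iff) metis
  with \<pi>(1) show ?thesis
    using that by blast
qed

section \<open>The Stirling function of a permutation\<close>

theorem theorem2:
  fixes k s :: nat and g :: "'a \<Rightarrow> 'a" and A :: "'a set"
  assumes "k \<ge> 3" and "odd k"
    and "finite A" and "g permutes A" and "card (perm_support g) = s"
  shows "\<exists>F. stirling_function (max s (4 * k)) F \<and>
           (\<forall>n > max s (4 * k). \<forall>r \<ge> 3. \<forall>\<iota>.
              inj_on \<iota> (perm_support g) \<and> \<iota> ` perm_support g \<subseteq> {1..n} \<longrightarrow>
              metric_intersection k n r (map_permutation (perm_support g) \<iota> g) =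
                F n (int n - int r * int k) + F n (int n - (int r - 1) * int k))"
proof -
  let ?S = "perm_support g" and ?t = "max s (4 * k)"
  have k: "1 \<le> k"
    using assms(1) by simp
  have g: "g permutes ?S"
    using assms(4) by (rule permutes_superset) (auto simp: perm_support_def)
  have "?S \<subseteq> A"
    using permutes_not_in[OF assms(4)] unfolding perm_support_def by auto
  then have "finite ?S"
    using assms(3) finite_subset by blast
  then obtain e where e: "bij_betw e ?S {1..s}"
    using assms(5) finite_same_card_bij[of ?S "{1..s}"] by auto
  \<comment> \<open>A reference copy of g: its support lies in every ground set beyond the threshold.\<close>
  define g0 where "g0 = map_permutation ?S e g"
  have "g0 permutes {1..s}"
    unfolding g0_def using e g by (rule map_permutation_permutes)
  then have g0: "g0 \<in> Sym ?t"
    unfolding Sym_def mem_Collect_eq by (rule permutes_subset) simp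
  have "ball_count k g0 n (int n - (m + int k)) \<le> ball_count k g0 n (int n - m)" for n m
    using ball_count_mono[of k g0 n "int n - m"] by (simp add: diff_diff_add)
  from stirling_function_split[OF stirling_function_ball_count[OF g0] k this]
  obtain F where F: "stirling_function ?t F"
    "\<And>n m. ?t \<le> n \<Longrightarrow> ball_count k g0 n (int n - m) = F n m + F n (m + int k)"
    by blast
  have "metric_intersection k n r (map_permutation ?S \<iota> g) =
      F n (int n - int r * int k) + F n (int n - (int r - 1) * int k)"
    if n: "?t < n" and r: "3 \<le> r" and \<iota>: "inj_on \<iota> ?S" "\<iota> ` ?S \<subseteq> {1..n}" for n r \<iota>
  proof -
    have "e ` ?S \<subseteq> {1..n}"
      using e n by (auto simp: bij_betw_def)
    then obtain \<pi> where \<pi>: "\<pi> permutes {1..n}" "map_permutation ?S \<iota> g = \<pi> \<circ> g0 \<circ> inv \<pi>"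
      using map_permutation_conj[OF g bij_betw_imp_inj_on[OF e] \<iota>(1) _ _ \<iota>(2)]
      unfolding g0_def by blast
    have "map_permutation ?S \<iota> g permutes \<iota> ` ?S"
      using \<iota>(1) g by (intro map_permutation_permutes) (auto simp: bij_betw_def)
    then have "map_permutation ?S \<iota> g \<in> Sym n"
      using \<iota>(2) permutes_subset unfolding Sym_def by blast
    then have "metric_intersection k n r (map_permutation ?S \<iota> g) =
        ball_count k (map_permutation ?S \<iota> g) n (int r * int k)"
      using k n r by (intro metric_intersection_eq_ball_count) auto
    also have "\<dots> = ball_count k g0 n (int r * int k)"
      unfolding \<pi>(2) using \<pi>(1) \<open>g0 permutes {1..s}\<close>
      by (intro ball_count_conj) (auto simp: Sym_def intro: permutes_bij)
    also have "\<dots> = F n (int n - int r * int k) + F n (int n - int r * int k + int k)"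
      using F(2)[of n "int n - int r * int k"] n by simp
    also have "int n - int r * int k + int k = int n - (int r - 1) * int k"
      by (simp add: algebra_simps)
    finally show ?thesis .
  qed
  with F(1) show ?thesis
    by blast
qed

end
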